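(* Let $\Gamma$ be a finite oriented simplicial complex on $n$ vertices, let $k>0$, let $\ell\ge1$ be an integer, and let $d_{\mathrm{up}}$ denote the maximum up-degree of a $k$-simplex of $\Gamma$. Then $$\Big(1-\frac{d_{\mathrm{up}}+k+1}{n}\Big)^{\ell}\frac{1}{|S_k|}\sum_{\sigma\in S_k}\|H|\sigma\rangle\|_1^{\ell}\;\le\;\mathbb{E}\big[|f_k(\overline{\boldsymbol\sigma})|^2\big]\;\le\;\frac{1}{|S_k|}\sum_{\sigma\in S_k}\|H|\sigma\rangle\|_1^{2\ell}.$$ Moreover, if $\overline{\sigma}_1,\dots,\overline{\sigma}_{N_p}$ are independent samples of $\overline{\boldsymbol\sigma}$ with $$N_p\ge\frac{1}{\eta\epsilon^2}\cdot\frac{1}{|S_k|}\sum_{\sigma\in S_k}\|H|\sigma\rangle\|_1^{2\ell},$$ then $\frac{1}{N_p}\sum_{i=1}^{N_p}f_k(\overline{\sigma}_i)$ is an $(\epsilon,\eta)$-estimate of $\frac{1}{|S_k|}\mathrm{tr}(H^\ell)$.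
   Context: A simplicial complex $\Gamma$ on vertex set $\{x_1,\dots,x_n\}$ is a family of subsets closed under taking subsets; $S_k$ is the set of its elements of size $k+1$ ($k$-simplices). It is oriented via $x_1<\dots<x_n$. The boundary map $\partial_k:\mathbb{C}S_k\to\mathbb{C}S_{k-1}$ sends $|\{x_{i_0},\dots,x_{i_k}\}\rangle$ ($i_0<\dots<i_k$) to $\sum_{j=0}^k(-1)^{j+1}|\{x_{i_0},\dots,x_{i_k}\}\setminus\{x_{i_j}\}\rangle$. $\Delta_k$ is the matrix of $\partial_k^\dagger\partial_k+\partial_{k+1}\partial_{k+1}^\dagger$ in the basis $\{|\sigma\rangle:\sigma\in S_k\}$, and $H=I-\frac1n\Delta_k$; $\|H|\sigma\rangle\|_1=\sum_{\tau}|H_{\tau\sigma}|$. The up-degree of $\sigma\in S_k$ is the number of $(k+1)$-simplices containing it. Define the Markov chain on $S_k$ with $P_{\sigma\tau}=|\langle\tau|H|\sigma\rangle|/\|H|\sigma\rangle\|_1$. The random path $\overline{\boldsymbol\sigma}=(\sigma_0,\dots,\sigma_\ell)$ has $\sigma_0$ uniform on $S_k$ and $\sigma_{i+1}$ drawn from $P_{\sigma_i,\cdot}$, i.e. has probability $p(\overline\sigma)=\frac{1}{|S_k|}\prod_{i=0}^{\ell-1}P_{\sigma_i\sigma_{i+1}}$. Define $f_k(\sigma_0,\dots,\sigma_\ell)=\langle\sigma_\ell|\sigma_0\rangle\prod_{i=0}^{\ell-1}(-1)^{s(\sigma_i,\sigma_{i+1})}\|H|\sigma_i\rangle\|_1$,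 where $\langle\sigma_\ell|\sigma_0\rangle$ is $1$ if $\sigma_\ell=\sigma_0$ and $0$ otherwise, and $(-1)^{s(\sigma_i,\sigma_{i+1})}$ is the sign of $\langle\sigma_i|H|\sigma_{i+1}\rangle$. A random variable $X$ is an $(\epsilon,\eta)$-estimate of $\mu\in\mathbb{R}$ if $\Pr[|X-\mu|>\epsilon]<\eta$. *)

theory Defs
  imports "HOL-Probability.Probability"
begin

text \<open>
  A complex on the ordered vertex set \<open>V\<close>; the orientation is the one given by the linear
  order on vertices. Elements of \<open>V\<close> are not required to be 0-simplices.
\<close>

definition ordered_simplicial_complex :: "'v::linorder set \<Rightarrow> 'v set set \<Rightarrow> bool" where
  "ordered_simplicial_complex V \<Gamma> \<longleftrightarrow>
     finite V \<and> \<Gamma> \<subseteq> Pow V \<and> (\<forall>\<sigma>\<in>\<Gamma>. \<forall>\<tau>. \<tau> \<subseteq> \<sigma> \<longrightarrow> \<tau> \<in> \<Gamma>)"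

definition simplices :: "'v set set \<Rightarrow> nat \<Rightarrow> 'v set set" where
  "simplices \<Gamma> k = {\<sigma> \<in> \<Gamma>. card \<sigma> = k + 1}"

definition up_degree :: "'v set set \<Rightarrow> nat \<Rightarrow> 'v set \<Rightarrow> nat" where
  "up_degree \<Gamma> k \<sigma> = card {\<tau> \<in> simplices \<Gamma> (k + 1). \<sigma> \<subseteq> \<tau>}"

definition max_up_degree :: "'v set set \<Rightarrow> nat \<Rightarrow> nat" where
  "max_up_degree \<Gamma> k = Max (up_degree \<Gamma> k ` simplices \<Gamma> k)"

text \<open>
  Matrices are functions of a row and a column index, both ranging over finite sets of simplices.
  \<open>boundary k \<tau> \<sigma>\<close> is the entry \<open>\<langle>\<tau>|\<partial>\<^sub>k|\<sigma>\<rangle>\<close>; in the list enumerating \<open>\<sigma>\<close> increasingly, entry \<open>j\<close> is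
  the vertex of index \<open>i\<^sub>j\<close>.
\<close>

definition boundary :: "nat \<Rightarrow> 'v::linorder set \<Rightarrow> 'v set \<Rightarrow> complex" where
  "boundary k \<tau> \<sigma> =
     (\<Sum>j=0..k. (-1) ^ (j + 1) * (if \<tau> = \<sigma> - {sorted_list_of_set \<sigma> ! j} then 1 else 0))"

text \<open>Meant for \<open>k > 0\<close>, because of the truncated \<open>k - 1\<close>.\<close>

definition laplacian :: "'v::linorder set set \<Rightarrow> nat \<Rightarrow> 'v set \<Rightarrow> 'v set \<Rightarrow> complex" where
  "laplacian \<Gamma> k \<sigma> \<tau> =
     (\<Sum>\<rho>\<in>simplices \<Gamma> (k - 1). cnj (boundary k \<rho> \<sigma>) * boundary k \<rho> \<tau>)
   + (\<Sum>\<rho>\<in>simplices \<Gamma> (k + 1). boundary (k + 1) \<sigma> \<rho> * cnj (boundary (k + 1) \<tau> \<rho>))"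

definition Hmat :: "nat \<Rightarrow> 'v::linorder set set \<Rightarrow> nat \<Rightarrow> 'v set \<Rightarrow> 'v set \<Rightarrow> complex" where
  "Hmat n \<Gamma> k \<sigma> \<tau> = (if \<sigma> = \<tau> then 1 else 0) - 1 / of_nat n * laplacian \<Gamma> k \<sigma> \<tau>"

definition Hnorm :: "nat \<Rightarrow> 'v::linorder set set \<Rightarrow> nat \<Rightarrow> 'v set \<Rightarrow> real" where
  "Hnorm n \<Gamma> k \<sigma> = (\<Sum>\<tau>\<in>simplices \<Gamma> k. cmod (Hmat n \<Gamma> k \<tau> \<sigma>))"

primrec mat_power :: "'i set \<Rightarrow> ('i \<Rightarrow> 'i \<Rightarrow> complex) \<Rightarrow> nat \<Rightarrow> 'i \<Rightarrow> 'i \<Rightarrow> complex" where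
  "mat_power I A 0 = (\<lambda>i j. if i = j then 1 else 0)"
| "mat_power I A (Suc m) = (\<lambda>i j. \<Sum>h\<in>I. A i h * mat_power I A m h j)"

definition mat_trace :: "'i set \<Rightarrow> ('i \<Rightarrow> 'i \<Rightarrow> complex) \<Rightarrow> complex" where
  "mat_trace I A = (\<Sum>i\<in>I. A i i)"

definition trans_prob :: "nat \<Rightarrow> 'v::linorder set set \<Rightarrow> nat \<Rightarrow> 'v set \<Rightarrow> 'v set \<Rightarrow> real" where
  "trans_prob n \<Gamma> k \<sigma> \<tau> = cmod (Hmat n \<Gamma> k \<tau> \<sigma>) / Hnorm n \<Gamma> k \<sigma>"

text \<open>
  If \<open>H|\<sigma>\<rangle> = 0\<close> (which happens, e.g. for the full simplex), the formula for the transition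
  probabilities out of \<open>\<sigma>\<close> reads \<open>0/0\<close>. The chain may then move from \<open>\<sigma>\<close> according to an
  arbitrary distribution on the \<open>k\<close>-simplices.
\<close>

definition transition_kernel ::
  "nat \<Rightarrow> 'v::linorder set set \<Rightarrow> nat \<Rightarrow> ('v set \<Rightarrow> 'v set pmf) \<Rightarrow> bool" where
  "transition_kernel n \<Gamma> k K \<longleftrightarrow>
     (\<forall>\<sigma>\<in>simplices \<Gamma> k. set_pmf (K \<sigma>) \<subseteq> simplices \<Gamma> k \<and>
        (Hnorm n \<Gamma> k \<sigma> \<noteq> 0 \<longrightarrow>
           (\<forall>\<tau>\<in>simplices \<Gamma> k. pmf (K \<sigma>) \<tau> = trans_prob n \<Gamma> k \<sigma> \<tau>)))"

primrec path_from :: "('a \<Rightarrow> 'a pmf) \<Rightarrow> nat \<Rightarrow> 'a \<Rightarrow> 'a list pmf" where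
  "path_from K 0 \<sigma> = return_pmf [\<sigma>]"
| "path_from K (Suc l) \<sigma> = bind_pmf (K \<sigma>) (\<lambda>\<tau>. map_pmf ((#) \<sigma>) (path_from K l \<tau>))"

definition random_path :: "'a set \<Rightarrow> ('a \<Rightarrow> 'a pmf) \<Rightarrow> nat \<Rightarrow> 'a list pmf" where
  "random_path S K l = bind_pmf (pmf_of_set S) (path_from K l)"

text \<open>The entries of \<open>H\<close> are real (lemma \<open>Hmat_real\<close> below), so their sign is that of the real part.\<close>

definition f_path :: "nat \<Rightarrow> 'v::linorder set set \<Rightarrow> nat \<Rightarrow> nat \<Rightarrow> 'v set list \<Rightarrow> real" where
  "f_path n \<Gamma> k l p =
     (if p ! l = p ! 0 then 1 else 0) *
     (\<Prod>i<l. sgn (Re (Hmat n \<Gamma> k (p ! i) (p ! (i + 1)))) * Hnorm n \<Gamma> k (p ! i))"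

definition is_estimate :: "'w measure \<Rightarrow> real \<Rightarrow> real \<Rightarrow> ('w \<Rightarrow> real) \<Rightarrow> real \<Rightarrow> bool" where
  "is_estimate M \<epsilon> \<eta> X \<mu> \<longleftrightarrow>
     X \<in> borel_measurable M \<and> measure M {\<omega> \<in> space M. \<bar>X \<omega> - \<mu>\<bar> > \<epsilon>} < \<eta>"

lemma boundary_real: "boundary k \<tau> \<sigma> \<in> \<real>"
  unfolding boundary_def by (intro sum_in_Reals Reals_mult Reals_power) auto

lemma Hmat_real: "Hmat n \<Gamma> k \<sigma> \<tau> \<in> \<real>"
proof -
  have "cnj (boundary a b c) \<in> \<real>" for a and b c :: "'a set"
    using boundary_real[of a b c] by (simp add: Reals_cnj_iff)
  then have "laplacian \<Gamma> k \<sigma> \<tau> \<in> \<real>"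
    unfolding laplacian_def by (intro Reals_add sum_in_Reals Reals_mult boundary_real)
  then show ?thesis
    unfolding Hmat_def by (intro Reals_diff Reals_mult Reals_divide) auto
qed

lemma mat_power_real:
  assumes "\<And>i j. A i j \<in> \<real>"
  shows "mat_power I A l i j \<in> \<real>"
  by (induction l arbitrary: i j) (auto intro!: sum_in_Reals Reals_mult assms)

lemma trace_Hmat_power_real:
  "mat_trace I (mat_power I (Hmat n \<Gamma> k) l) \<in> \<real>"
  unfolding mat_trace_def by (intro sum_in_Reals mat_power_real Hmat_real)

lemma pmf_path_from:
  assumes "length p = l + 1"
  shows "pmf (path_from K l \<sigma>) p =
    (if p ! 0 = \<sigma> then \<Prod>i<l. pmf (K (p ! i)) (p ! (i + 1)) else 0)"
  using assms
proof (induction l arbitrary: \<sigma> p)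
  case 0
  then obtain a where "p = [a]" by (auto simp: length_Suc_conv)
  then show ?case by (auto simp: pmf_return)
next
  case (Suc l)
  then obtain a q where p: "p = a # q" and q: "length q = l + 1"
    by (auto simp: length_Suc_conv)
  have *: "pmf (map_pmf ((#) \<sigma>) (path_from K l \<tau>)) p =
      (if a = \<sigma> then pmf (path_from K l \<tau>) q else 0)" for \<tau>
  proof (cases "a = \<sigma>")
    case True
    then show ?thesis unfolding p by (simp add: pmf_map_inj')
  next
    case False
    then show ?thesis unfolding p by (auto simp: pmf_eq_0_set_pmf)
  qed
  have "pmf (path_from K (Suc l) \<sigma>) p =
      measure_pmf.expectation (K \<sigma>) (\<lambda>\<tau>. if a = \<sigma> then pmf (path_from K l \<tau>) q else 0)"
    by (simp add: pmf_bind *)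
  also have "\<dots> = measure_pmf.expectation (K \<sigma>)
      (\<lambda>\<tau>. indicator {q ! 0} \<tau> *
        (if a = \<sigma> then \<Prod>i<l. pmf (K (q ! i)) (q ! (i + 1)) else 0))"
    by (intro Bochner_Integration.integral_cong) (auto simp: Suc.IH[OF q] indicator_def)
  also have "\<dots> = pmf (K \<sigma>) (q ! 0) *
      (if a = \<sigma> then \<Prod>i<l. pmf (K (q ! i)) (q ! (i + 1)) else 0)"
    by (simp add: measure_pmf_single)
  also have "\<dots> = (if p ! 0 = \<sigma> then \<Prod>i<Suc l. pmf (K (p ! i)) (p ! (i + 1)) else 0)"
    unfolding p prod.lessThan_Suc_shift by simp
  finally show ?case .
qed

lemma pmf_random_path:
  assumes "finite S" "S \<noteq> {}" "length p = l + 1" "p ! 0 \<in> S"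
  shows "pmf (random_path S K l) p =
    1 / real (card S) * (\<Prod>i<l. pmf (K (p ! i)) (p ! (i + 1)))"
proof -
  have "pmf (random_path S K l) p = (\<Sum>\<sigma>\<in>S. pmf (path_from K l \<sigma>) p) / real (card S)"
    using assms by (simp add: random_path_def pmf_bind_pmf_of_set)
  also have "(\<Sum>\<sigma>\<in>S. pmf (path_from K l \<sigma>) p) = (\<Prod>i<l. pmf (K (p ! i)) (p ! (i + 1)))"
    using assms by (simp add: pmf_path_from[OF assms(3)])
  finally show ?thesis by simp
qed

lemma transition_kernel_exists:
  assumes "finite (simplices \<Gamma> k)"
  shows "\<exists>K. transition_kernel n \<Gamma> k K"
proof -
  let ?S = "simplices \<Gamma> k"
  have "\<exists>q. set_pmf q \<subseteq> ?S \<and>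
      (Hnorm n \<Gamma> k \<sigma> \<noteq> 0 \<longrightarrow> (\<forall>\<tau>\<in>?S. pmf q \<tau> = trans_prob n \<Gamma> k \<sigma> \<tau>))"
    if \<sigma>: "\<sigma> \<in> ?S" for \<sigma>
  proof (cases "Hnorm n \<Gamma> k \<sigma> = 0")
    case True
    then show ?thesis using \<sigma> by (intro exI[of _ "return_pmf \<sigma>"]) auto
  next
    case False
    define g where "g \<tau> = (if \<tau> \<in> ?S then trans_prob n \<Gamma> k \<sigma> \<tau> else 0)" for \<tau>
    have nn: "g \<tau> \<ge> 0" for \<tau>
      by (simp add: g_def trans_prob_def Hnorm_def sum_nonneg)
    have sum: "(\<Sum>\<tau>\<in>?S. g \<tau>) = 1"
      using False by (simp add: g_def trans_prob_def Hnorm_def flip: sum_divide_distrib)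
    have "(\<integral>\<^sup>+ \<tau>. ennreal (g \<tau>) \<partial>count_space UNIV) = (\<Sum>\<tau>\<in>?S. ennreal (g \<tau>))"
      using assms by (intro nn_integral_count_space'[where A = ?S]) (auto simp: g_def)
    also have "\<dots> = 1" using nn sum by (simp add: sum_ennreal)
    finally have pmf: "pmf (embed_pmf g) \<tau> = g \<tau>" for \<tau>
      using nn by (intro pmf_embed_pmf) auto
    show ?thesis
      by (intro exI[of _ "embed_pmf g"]) (auto simp: pmf set_pmf_eq g_def split: if_splits)
  qed
  then show ?thesis unfolding transition_kernel_def by metis
qed

end

theory Submission
  imports Defs
begin

text \<open>
  Let \<open>A = |H|\<close> entrywise, let \<open>c\<close> be its row sums and \<open>D = diag c\<close>. Summing over paths, the second
  moment of \<open>f\<^sub>k\<close> is \<open>tr ((D A)\<^sup>l) / |S\<^sub>k|\<close> and its mean is \<open>tr (H\<^sup>l) / |S\<^sub>k|\<close>.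

  Lower bound: keep only the constant walks; \<open>H\<^sub>\<sigma>\<^sub>\<sigma> = 1 - (deg \<sigma> + k + 1) / n\<close>, with \<open>deg\<close> the up-degree.

  Upper bound: bound one edge of a closed walk by a row sum. What is left has the form
  \<open>\<Sum>\<^sub>i\<^sub>j c\<^sub>i\<^sup>q M\<^sub>i\<^sub>j c\<^sub>j\<^sup>r\<close> with \<open>M = A (D A)\<^sup>m\<close> symmetric and nonnegative, so
  \<open>x\<^sup>q y\<^sup>r + y\<^sup>q x\<^sup>r \<le> x\<^sup>q\<^sup>+\<^sup>r + y\<^sup>q\<^sup>+\<^sup>r\<close> moves all powers of \<open>c\<close> to the first endpoint. The last edge
  and its weight then sum to \<open>c\<^sub>j\<^sup>2\<close>, and the argument repeats with a shorter walk.

  The estimate is Chebyshev's inequality, which is strict for the event \<open>|X - \<mu>| > \<epsilon>\<close> unless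
  that event is null.
\<close>

subsection \<open>Sums over walks\<close>

text \<open>The power \<open>B ^ m\<close> of a real matrix indexed by \<open>S\<close>. Unlike
  \<open>mat_power\<close> it lives in an ordered field, so walks can be compared entrywise.\<close>

primrec walk_sum :: "'i set \<Rightarrow> ('i \<Rightarrow> 'i \<Rightarrow> real) \<Rightarrow> nat \<Rightarrow> 'i \<Rightarrow> 'i \<Rightarrow> real" where
  "walk_sum S B 0 = (\<lambda>i j. if i = j then 1 else 0)"
| "walk_sum S B (Suc m) = (\<lambda>i j. \<Sum>h\<in>S. B i h * walk_sum S B m h j)"

lemma walk_sum_nonneg:
  assumes "\<And>i j. i \<in> S \<Longrightarrow> j \<in> S \<Longrightarrow> 0 \<le> B i j" and "i \<in> S"
  shows "0 \<le> walk_sum S B m i j"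
  using assms(2) by (induction m arbitrary: i) (auto intro!: sum_nonneg mult_nonneg_nonneg assms(1))

lemma walk_sum_cong:
  assumes "\<And>i j. i \<in> S \<Longrightarrow> j \<in> S \<Longrightarrow> B i j = B' i j" and "i \<in> S"
  shows "walk_sum S B m i j = walk_sum S B' m i j"
  using assms(2) by (induction m arbitrary: i) (auto intro!: sum.cong simp: assms(1))

lemma mat_power_of_real:
  "mat_power S (\<lambda>i j. complex_of_real (B i j)) m i j = of_real (walk_sum S B m i j)"
  by (induction m arbitrary: i j) auto

text \<open>The walk that stays at \<open>i\<close> is one of the walks from \<open>i\<close> to
  \<open>i\<close>, and all others have nonnegative weight.\<close>

lemma diagonal_power_le_walk_sum:
  assumes "finite S" and B: "\<And>i j. i \<in> S \<Longrightarrow> j \<in> S \<Longrightarrow> 0 \<le> B i j" and i: "i \<in> S"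
  shows "B i i ^ m \<le> walk_sum S B m i i"
proof (induction m)
  case (Suc m)
  have "B i i ^ Suc m \<le> B i i * walk_sum S B m i i"
    using Suc B[OF i i] by (simp add: mult_left_mono)
  also have "\<dots> \<le> (\<Sum>h\<in>S. B i h * walk_sum S B m h i)"
    using assms by (intro member_le_sum mult_nonneg_nonneg walk_sum_nonneg) auto
  finally show ?case by simp
qed simp

text \<open>
  For the row sums \<open>c\<close> of \<open>A\<close> and \<open>D = diag c\<close> this is the matrix \<open>A (D A)\<^sup>m\<close>. Unlike \<open>(D A)\<^sup>m\<close>
  it is symmetric when \<open>A\<close> is.
\<close>

primrec weighted_kernel ::
  "'i set \<Rightarrow> ('i \<Rightarrow> 'i \<Rightarrow> real) \<Rightarrow> ('i \<Rightarrow> real) \<Rightarrow> nat \<Rightarrow> 'i \<Rightarrow> 'i \<Rightarrow> real" where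
  "weighted_kernel S A c 0 = A"
| "weighted_kernel S A c (Suc m) = (\<lambda>i j. \<Sum>h\<in>S. A i h * c h * weighted_kernel S A c m h j)"

text \<open>With the leading weight of \<open>(D A) ^ (m + 1)\<close> split off, a kernel remains
  that is symmetric for symmetric \<open>A\<close>.\<close>

lemma walk_sum_Suc_eq_weighted_kernel:
  assumes "finite S" "j \<in> S"
  shows "walk_sum S (\<lambda>i j. c i * A i j) (Suc m) i j = c i * weighted_kernel S A c m i j"
proof (induction m arbitrary: i)
  case 0
  \<comment> \<open>The identity matrix at the end of the recursion picks out \<open>h = j\<close>,
    a summand because \<open>j\<close> lies in \<open>S\<close>.\<close>
  have "(\<Sum>h\<in>S. c i * A i h * (if h = j then 1 else 0)) = (\<Sum>h\<in>S. if h = j then c i * A i h else 0)"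
    by (intro sum.cong) auto
  then show ?case using assms by simp
next
  case (Suc m)
  have "walk_sum S (\<lambda>i j. c i * A i j) (Suc (Suc m)) i j
      = (\<Sum>h\<in>S. c i * A i h * walk_sum S (\<lambda>i j. c i * A i j) (Suc m) h j)" by simp
  also have "\<dots> = c i * weighted_kernel S A c (Suc m) i j"
    unfolding Suc.IH by (simp add: sum_distrib_left mult_ac)
  finally show ?case .
qed

text \<open>Associativity of the matrix product. It gives access to the last edge of a walk, for
  reversing the walk and for summing out its endpoint.\<close>

lemma weighted_kernel_Suc_right:
  "weighted_kernel S A c (Suc m) i j = (\<Sum>h\<in>S. weighted_kernel S A c m i h * c h * A h j)"
proof (induction m arbitrary: i)
  case (Suc m)
  have "weighted_kernel S A c (Suc (Suc m)) i j
      = (\<Sum>g\<in>S. A i g * c g * (\<Sum>h\<in>S. weighted_kernel S A c m g h * c h * A h j))"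
    by (simp only: weighted_kernel.simps(2)[of _ _ _ "Suc m"] Suc.IH)
  also have "\<dots> = (\<Sum>h\<in>S. \<Sum>g\<in>S. A i g * c g * (weighted_kernel S A c m g h * c h * A h j))"
    unfolding sum_distrib_left by (rule sum.swap)
  also have "\<dots> = (\<Sum>h\<in>S. weighted_kernel S A c (Suc m) i h * c h * A h j)"
    by (simp add: sum_distrib_left sum_distrib_right mult_ac)
  finally show ?case .
qed simp

text \<open>A walk and its reversal carry the same weight, since \<open>c\<close> is evaluated at
  interior vertices only. The induction peels the last edge of one against the first edge of the
  other.\<close>

lemma weighted_kernel_sym:
  assumes "\<And>i j. i \<in> S \<Longrightarrow> j \<in> S \<Longrightarrow> A i j = A j i" and "i \<in> S" "j \<in> S"
  shows "weighted_kernel S A c m i j = weighted_kernel S A c m j i"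
  using assms(2,3)
proof (induction m arbitrary: i j)
  case (Suc m)
  have "weighted_kernel S A c (Suc m) i j = (\<Sum>h\<in>S. weighted_kernel S A c m i h * c h * A h j)"
    by (rule weighted_kernel_Suc_right)
  also have "\<dots> = (\<Sum>h\<in>S. A j h * c h * weighted_kernel S A c m h i)"
  proof (rule sum.cong)
    fix h assume "h \<in> S"
    then show "weighted_kernel S A c m i h * c h * A h j = A j h * c h * weighted_kernel S A c m h i"
      using Suc.IH[of i h] assms(1)[of h j] Suc.prems by simp
  qed simp
  finally show ?case by simp
qed (simp add: assms(1))

lemma weighted_kernel_nonneg:
  assumes "\<And>i j. i \<in> S \<Longrightarrow> j \<in> S \<Longrightarrow> 0 \<le> A i j" "\<And>i. i \<in> S \<Longrightarrow> 0 \<le> c i" "i \<in> S" "j \<in> S"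
  shows "0 \<le> weighted_kernel S A c m i j"
  using assms(3) by (induction m arbitrary: i) (auto intro!: sum_nonneg mult_nonneg_nonneg assms)

section \<open>Symmetric nonnegative kernels and powers of row sums\<close>

text \<open>Powers are monotone on the nonnegative reals, so \<open>x ^ a - y ^ a\<close> and
  \<open>x ^ b - y ^ b\<close> never have opposite signs; expand their product.\<close>

lemma rearrangement_powers:
  fixes x y :: real
  assumes "0 \<le> x" "0 \<le> y"
  shows "x ^ a * y ^ b + y ^ a * x ^ b \<le> x ^ (a + b) + y ^ (a + b)"
proof -
  have "0 \<le> (x ^ a - y ^ a) * (x ^ b - y ^ b)"
  proof (cases "x \<le> y")
    case True
    then show ?thesis using assms by (intro mult_nonpos_nonpos) (auto simp: power_mono)
  next
    case False
    then show ?thesis using assms by (intro mult_nonneg_nonneg) (auto simp: power_mono)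
  qed
  then show ?thesis by (simp add: algebra_simps power_add)
qed

text \<open>By symmetry of \<open>M\<close>, each double sum equals its copy with the weights at
  \<open>i\<close> and \<open>j\<close> exchanged. Adding the two copies produces the shape of
  \<open>rearrangement_powers\<close>.\<close>

lemma symmetric_kernel_powers_le:
  fixes M :: "'i \<Rightarrow> 'i \<Rightarrow> real"
  assumes sym: "\<And>i j. i \<in> S \<Longrightarrow> j \<in> S \<Longrightarrow> M i j = M j i"
    and nn: "\<And>i j. i \<in> S \<Longrightarrow> j \<in> S \<Longrightarrow> 0 \<le> M i j"
    and c: "\<And>i. i \<in> S \<Longrightarrow> 0 \<le> c i"
  shows "(\<Sum>i\<in>S. \<Sum>j\<in>S. c i ^ a * M i j * c j ^ b) \<le> (\<Sum>i\<in>S. \<Sum>j\<in>S. c i ^ (a + b) * M i j)"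
    (is "?L \<le> ?R")
proof -
  have flip: "(\<Sum>i\<in>S. \<Sum>j\<in>S. g i j * M i j) = (\<Sum>i\<in>S. \<Sum>j\<in>S. g j i * M i j)" for g
    by (subst sum.swap) (auto intro!: sum.cong simp: sym)
  have "?L = (\<Sum>i\<in>S. \<Sum>j\<in>S. c i ^ a * c j ^ b * M i j)" by (simp add: mult_ac)
  then have "2 * ?L = (\<Sum>i\<in>S. \<Sum>j\<in>S. (c i ^ a * c j ^ b + c j ^ a * c i ^ b) * M i j)"
    using flip[of "\<lambda>i j. c i ^ a * c j ^ b"] by (simp add: distrib_right sum.distrib)
  also have "\<dots> \<le> (\<Sum>i\<in>S. \<Sum>j\<in>S. (c i ^ (a + b) + c j ^ (a + b)) * M i j)"
    by (intro sum_mono mult_right_mono rearrangement_powers nn c)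
  also have "\<dots> = 2 * ?R"
    using flip[of "\<lambda>i j. c i ^ (a + b)"] by (simp add: distrib_right sum.distrib)
  finally show ?thesis by simp
qed

context
  fixes S :: "'i set" and A :: "'i \<Rightarrow> 'i \<Rightarrow> real" and c :: "'i \<Rightarrow> real"
  assumes fin: "finite S"
    and sym: "\<And>i j. i \<in> S \<Longrightarrow> j \<in> S \<Longrightarrow> A i j = A j i"
    and nn: "\<And>i j. i \<in> S \<Longrightarrow> j \<in> S \<Longrightarrow> 0 \<le> A i j"
    and rows: "\<And>i. i \<in> S \<Longrightarrow> (\<Sum>j\<in>S. A i j) = c i"
begin

lemma row_sum_nonneg: "i \<in> S \<Longrightarrow> 0 \<le> c i"
  using rows[of i] nn by (metis sum_nonneg)

text \<open>The exponent counts \<open>m + 1\<close> edges and \<open>m\<close> interior weights,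
  each worth one power of \<open>c\<close>. \<open>q\<close> varies in the induction because every
  step moves two powers to the first endpoint.\<close>

lemma weighted_kernel_power_sum_le:
  "(\<Sum>i\<in>S. \<Sum>j\<in>S. c i ^ q * weighted_kernel S A c m i j) \<le> (\<Sum>i\<in>S. c i ^ (q + 2 * m + 1))"
proof (induction m arbitrary: q)
  case 0
  then show ?case by (simp add: rows power_Suc2 flip: sum_distrib_left del: power_Suc)
next
  case (Suc m)
  \<comment> \<open>Summing the last edge over \<open>j\<close> yields a second factor
    \<open>c h\<close> beside the weight already at \<open>h\<close>.\<close>
  have "(\<Sum>j\<in>S. weighted_kernel S A c (Suc m) i j) = (\<Sum>h\<in>S. weighted_kernel S A c m i h * c h ^ 2)" for i
    unfolding weighted_kernel_Suc_right
    by (subst sum.swap) (auto intro!: sum.cong simp: rows power2_eq_square simp flip: sum_distrib_left)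
  then have "(\<Sum>i\<in>S. \<Sum>j\<in>S. c i ^ q * weighted_kernel S A c (Suc m) i j)
      = (\<Sum>i\<in>S. \<Sum>j\<in>S. c i ^ q * weighted_kernel S A c m i j * c j ^ 2)"
    by (simp only: sum_distrib_left[symmetric] mult.assoc)
  also have "\<dots> \<le> (\<Sum>i\<in>S. \<Sum>j\<in>S. c i ^ (q + 2) * weighted_kernel S A c m i j)"
    by (intro symmetric_kernel_powers_le weighted_kernel_sym weighted_kernel_nonneg sym nn row_sum_nonneg)
  also have "\<dots> \<le> (\<Sum>i\<in>S. c i ^ (q + 2 * Suc m + 1))"
    using Suc.IH[of "q + 2"] by (simp add: algebra_simps)
  finally show ?case .
qed

lemma trace_row_weighted_power_le:
  assumes "l \<ge> 1"
  shows "(\<Sum>i\<in>S. walk_sum S (\<lambda>i j. c i * A i j) l i i) \<le> (\<Sum>i\<in>S. c i ^ (2 * l))"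
proof -
  obtain m where l: "l = Suc m" using assms by (cases l) auto
  \<comment> \<open>Symmetry lets the edge from \<open>j\<close> to \<open>i\<close> be charged to
    the row sum at \<open>i\<close> rather than at \<open>j\<close>.\<close>
  have le: "A j i \<le> c i" if "i \<in> S" "j \<in> S" for i j
  proof -
    have "A i j \<le> (\<Sum>j\<in>S. A i j)" using that fin nn by (intro member_le_sum) auto
    then show ?thesis using rows[OF that(1)] sym[OF that] by simp
  qed
  have "(\<Sum>i\<in>S. walk_sum S (\<lambda>i j. c i * A i j) l i i) = (\<Sum>i\<in>S. c i * weighted_kernel S A c m i i)"
    unfolding l using fin by (intro sum.cong walk_sum_Suc_eq_weighted_kernel) auto
  also have "\<dots> \<le> (\<Sum>i\<in>S. c i ^ (2 * l))"
  \<comment> \<open>For \<open>l = 1\<close> the closed walk is a single loop, and bounding it by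
    its row sum suffices. Longer walks have a separate closing edge.\<close>
  proof (cases m)
    case 0
    have "c i * A i i \<le> c i ^ 2" if "i \<in> S" for i
      using le[OF that that] row_sum_nonneg[OF that] by (simp add: power2_eq_square mult_left_mono)
    then show ?thesis using 0 l by (auto intro: sum_mono)
  next
    case (Suc p)
    have "(\<Sum>i\<in>S. c i * weighted_kernel S A c m i i)
        = (\<Sum>i\<in>S. \<Sum>j\<in>S. c i * (weighted_kernel S A c p i j * c j * A j i))"
      unfolding Suc weighted_kernel_Suc_right sum_distrib_left ..
    \<comment> \<open>Bounding the closing edge by \<open>c i\<close> turns the trace into a sum
      over independent endpoints \<open>i\<close> and \<open>j\<close>.\<close>
    also have "\<dots> \<le> (\<Sum>i\<in>S. \<Sum>j\<in>S. c i * (weighted_kernel S A c p i j * c j * c i))"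
      by (intro sum_mono mult_left_mono mult_nonneg_nonneg weighted_kernel_nonneg le nn row_sum_nonneg)
    also have "\<dots> = (\<Sum>i\<in>S. \<Sum>j\<in>S. c i ^ 2 * weighted_kernel S A c p i j * c j ^ 1)"
      by (simp add: power2_eq_square mult_ac)
    also have "\<dots> \<le> (\<Sum>i\<in>S. \<Sum>j\<in>S. c i ^ (2 + 1) * weighted_kernel S A c p i j)"
      by (intro symmetric_kernel_powers_le weighted_kernel_sym weighted_kernel_nonneg sym nn row_sum_nonneg)
    also have "\<dots> \<le> (\<Sum>i\<in>S. c i ^ (2 + 1 + 2 * p + 1))"
      by (rule weighted_kernel_power_sum_le)
    also have "2 + 1 + 2 * p + 1 = 2 * l" using l Suc by simp
    finally show ?thesis .
  qed
  finally show ?thesis .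
qed

end

section \<open>Expectations along random paths\<close>

text \<open>Finite support allows expectations over binds to be expanded into finite sums.\<close>

lemma finite_set_path_from:
  assumes "finite S" "\<And>\<sigma>. \<sigma> \<in> S \<Longrightarrow> set_pmf (K \<sigma>) \<subseteq> S" "\<sigma> \<in> S"
  shows "finite (set_pmf (path_from K l \<sigma>))"
  using assms(3)
proof (induction l arbitrary: \<sigma>)
  case (Suc l)
  have "finite (set_pmf (K \<sigma>))" using assms(1,2) Suc.prems finite_subset by blast
  then show ?case using Suc assms(2) by (auto simp: subset_iff)
qed simp

lemma set_path_from_nth_0: "p \<in> set_pmf (path_from K l \<sigma>) \<Longrightarrow> p ! 0 = \<sigma>"
  by (cases l) auto

text \<open>Conditioning on the first step reproduces the recursion of a matrix power: averaging the
  edge factor \<open>g\<close> over the transition gives the entry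
  \<open>pmf (K i) j * g i j\<close>.\<close>

lemma expectation_path_from:
  fixes g :: "'a \<Rightarrow> 'a \<Rightarrow> real"
  assumes fin: "finite S" and K: "\<And>\<sigma>. \<sigma> \<in> S \<Longrightarrow> set_pmf (K \<sigma>) \<subseteq> S" and \<sigma>: "\<sigma> \<in> S"
  shows "measure_pmf.expectation (path_from K l \<sigma>)
      (\<lambda>p. (if p ! l = t then 1 else 0) * (\<Prod>i<l. g (p ! i) (p ! (i + 1))))
    = walk_sum S (\<lambda>i j. pmf (K i) j * g i j) l \<sigma> t"
  using \<sigma>
proof (induction l arbitrary: \<sigma>)
  case (Suc l)
  let ?F = "\<lambda>l p. (if p ! l = t then 1 else 0) * (\<Prod>i<l. g (p ! i) (p ! (i + 1)))"
  have step: "measure_pmf.expectation (map_pmf ((#) \<sigma>) (path_from K l \<tau>)) (?F (Suc l))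
      = g \<sigma> \<tau> * walk_sum S (\<lambda>i j. pmf (K i) j * g i j) l \<tau> t" if "\<tau> \<in> S" for \<tau>
  proof -
    have "measure_pmf.expectation (map_pmf ((#) \<sigma>) (path_from K l \<tau>)) (?F (Suc l))
        = measure_pmf.expectation (path_from K l \<tau>) (\<lambda>p. ?F (Suc l) (\<sigma> # p))"
      by (rule integral_map_pmf)
    \<comment> \<open>The tail almost surely starts at \<open>\<tau>\<close>, so the factor of the
      first edge is the constant \<open>g \<sigma> \<tau>\<close>.\<close>
    also have "\<dots> = measure_pmf.expectation (path_from K l \<tau>) (\<lambda>p. g \<sigma> \<tau> * ?F l p)"
      by (intro integral_cong_AE)
        (auto simp: AE_measure_pmf_iff prod.lessThan_Suc_shift set_path_from_nth_0
          simp del: prod.lessThan_Suc)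
    finally show ?thesis using Suc.IH[OF that] by simp
  qed
  have "measure_pmf.expectation (path_from K (Suc l) \<sigma>) (?F (Suc l))
      = (\<Sum>\<tau>\<in>S. pmf (K \<sigma>) \<tau> *\<^sub>R
          measure_pmf.expectation (map_pmf ((#) \<sigma>) (path_from K l \<tau>)) (?F (Suc l)))"
    unfolding path_from.simps
    by (rule pmf_expectation_bind) (use fin K Suc.prems finite_set_path_from[of S K] in auto)
  also have "\<dots> = walk_sum S (\<lambda>i j. pmf (K i) j * g i j) (Suc l) \<sigma> t"
    by (simp only: step real_scaleR_def walk_sum.simps mult.assoc cong: sum.cong)
  finally show ?case .
qed simp

text \<open>The uniform start averages the diagonal entries, so an estimator supported on closed
  paths has a normalised trace as its mean.\<close>

lemma expectation_random_path_closed: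
  fixes g :: "'a \<Rightarrow> 'a \<Rightarrow> real"
  assumes fin: "finite S" and ne: "S \<noteq> {}" and K: "\<And>\<sigma>. \<sigma> \<in> S \<Longrightarrow> set_pmf (K \<sigma>) \<subseteq> S"
  shows "measure_pmf.expectation (random_path S K l)
      (\<lambda>p. (if p ! l = p ! 0 then 1 else 0) * (\<Prod>i<l. g (p ! i) (p ! (i + 1))))
    = 1 / real (card S) * (\<Sum>\<sigma>\<in>S. walk_sum S (\<lambda>i j. pmf (K i) j * g i j) l \<sigma> \<sigma>)"
proof -
  let ?F = "\<lambda>p. (if p ! l = p ! 0 then 1 else 0) * (\<Prod>i<l. g (p ! i) (p ! (i + 1)))"
  have "measure_pmf.expectation (path_from K l \<sigma>) ?F
      = walk_sum S (\<lambda>i j. pmf (K i) j * g i j) l \<sigma> \<sigma>" if "\<sigma> \<in> S" for \<sigma>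
  proof -
    \<comment> \<open>Given the start, the path-dependent target \<open>p ! 0\<close> becomes the
      fixed target \<open>\<sigma>\<close>.\<close>
    have "measure_pmf.expectation (path_from K l \<sigma>) ?F = measure_pmf.expectation (path_from K l \<sigma>)
        (\<lambda>p. (if p ! l = \<sigma> then 1 else 0) * (\<Prod>i<l. g (p ! i) (p ! (i + 1))))"
      by (intro integral_cong_AE) (auto simp: AE_measure_pmf_iff dest: set_path_from_nth_0)
    then show ?thesis using expectation_path_from[OF fin K that] by simp
  qed
  moreover have "measure_pmf.expectation (random_path S K l) ?F
      = (\<Sum>\<sigma>\<in>S. measure_pmf.expectation (path_from K l \<sigma>) ?F /\<^sub>R real (card S))"
    unfolding random_path_def
    by (rule pmf_expectation_bind_pmf_of_set) (use assms finite_set_path_from[of S K] in auto)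
  ultimately show ?thesis by (simp add: sum_distrib_left field_simps)
qed

lemma finite_set_random_path:
  assumes "finite S" "S \<noteq> {}" "\<And>\<sigma>. \<sigma> \<in> S \<Longrightarrow> set_pmf (K \<sigma>) \<subseteq> S"
  shows "finite (set_pmf (random_path S K l))"
  using assms finite_set_path_from[of S K] by (auto simp: random_path_def)

subsection \<open>The Laplacian of a simplicial complex\<close>

text \<open>The entry is a sign at a facet and zero elsewhere. This turns diagonal entries of the
  Laplacian into counts.\<close>

lemma boundary_mult_cnj:
  assumes fin: "finite \<sigma>" and card: "card \<sigma> = k + 1"
  shows "boundary k \<tau> \<sigma> * cnj (boundary k \<tau> \<sigma>) = (if \<exists>v\<in>\<sigma>. \<tau> = \<sigma> - {v} then 1 else 0)"
proof -
  let ?xs = "sorted_list_of_set \<sigma>"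
  have len: "length ?xs = k + 1" and set: "set ?xs = \<sigma>" and dist: "distinct ?xs"
    using assms by auto
  show ?thesis
  proof (cases "\<exists>v\<in>\<sigma>. \<tau> = \<sigma> - {v}")
    case True
    then obtain j where j: "j \<le> k" "\<tau> = \<sigma> - {?xs ! j}"
      using set len by (metis in_set_conv_nth less_Suc_eq_le Suc_eq_plus1)
    \<comment> \<open>Removing distinct vertices gives distinct facets, so exactly one summand
      survives.\<close>
    have "\<tau> = \<sigma> - {?xs ! i} \<longleftrightarrow> i = j" if "i \<in> {0..k}" for i
    proof -
      have "i < length ?xs" "j < length ?xs" using that j(1) len by auto
      then have "?xs ! i \<in> \<sigma>" "?xs ! j \<in> \<sigma>" "?xs ! i = ?xs ! j \<longleftrightarrow> i = j"
        using set nth_mem[of _ ?xs] dist by (auto simp: nth_eq_iff_index_eq)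
      then show ?thesis using j(2) by blast
    qed
    then have "boundary k \<tau> \<sigma> = (\<Sum>i=0..k. if i = j then (-1) ^ (i + 1) else 0)"
      unfolding boundary_def by (intro sum.cong) auto
    also have "\<dots> = (-1) ^ (j + 1)" using j(1) by simp
    finally show ?thesis using True by (simp flip: power_mult_distrib)
  next
    case False
    have "\<tau> \<noteq> \<sigma> - {?xs ! i}" if "i \<in> {0..k}" for i
      using False that nth_mem[of i ?xs] set len by auto
    then have "boundary k \<tau> \<sigma> = 0" unfolding boundary_def by (intro sum.neutral) auto
    then show ?thesis using False by simp
  qed
qed

lemma laplacian_cnj: "cnj (laplacian \<Gamma> k \<sigma> \<tau>) = laplacian \<Gamma> k \<tau> \<sigma>"
  by (simp add: laplacian_def mult.commute)

text \<open>The Laplacian is Hermitian. Hence the column sum \<open>Hnorm\<close> is also a row sum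
  of the absolute values, as the walk bounds require.\<close>

lemma cmod_Hmat_sym: "cmod (Hmat n \<Gamma> k \<sigma> \<tau>) = cmod (Hmat n \<Gamma> k \<tau> \<sigma>)"
proof -
  have "Hmat n \<Gamma> k \<sigma> \<tau> = cnj (Hmat n \<Gamma> k \<tau> \<sigma>)"
    by (simp add: Hmat_def laplacian_cnj)
  then show ?thesis by simp
qed

context
  fixes V :: "'v::linorder set" and \<Gamma> :: "'v set set"
  assumes cpx: "ordered_simplicial_complex V \<Gamma>"
begin

lemma finite_simplices: "finite (simplices \<Gamma> k)"
  using cpx finite_subset[of \<Gamma> "Pow V"]
  by (auto simp: ordered_simplicial_complex_def simplices_def)

lemma finite_simplex: "\<sigma> \<in> simplices \<Gamma> k \<Longrightarrow> finite \<sigma>"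
  by (auto simp: simplices_def intro: card_ge_0_finite)

text \<open>The down part counts facets, all \<open>k + 1\<close> of which belong to the complex;
  the up part counts cofacets.\<close>

lemma laplacian_diag:
  assumes "k > 0" and \<sigma>: "\<sigma> \<in> simplices \<Gamma> k"
  shows "laplacian \<Gamma> k \<sigma> \<sigma> = of_nat (up_degree \<Gamma> k \<sigma> + k + 1)"
proof -
  have card: "card \<sigma> = k + 1" and fin: "finite \<sigma>" and mem: "\<sigma> \<in> \<Gamma>"
    using \<sigma> finite_simplex[OF \<sigma>] by (auto simp: simplices_def)
  have "{\<rho> \<in> simplices \<Gamma> (k - 1). \<exists>v\<in>\<sigma>. \<rho> = \<sigma> - {v}} = (\<lambda>v. \<sigma> - {v}) ` \<sigma>"
  proof -
    have "\<sigma> - {v} \<in> simplices \<Gamma> (k - 1)" if "v \<in> \<sigma>" for v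
    proof -
      have "\<sigma> - {v} \<in> \<Gamma>" using cpx mem Diff_subset[of \<sigma> "{v}"] by (simp add: ordered_simplicial_complex_def)
      \<comment> \<open>A facet has \<open>k\<close> vertices, and \<open>k = (k - 1) + 1\<close>
        because \<open>k > 0\<close>.\<close>
      then show ?thesis using that card fin assms(1) by (simp add: simplices_def)
    qed
    then show ?thesis by auto
  qed
  moreover have "inj_on (\<lambda>v. \<sigma> - {v}) \<sigma>" by (auto simp: inj_on_def)
  ultimately have down: "card {\<rho> \<in> simplices \<Gamma> (k - 1). \<exists>v\<in>\<sigma>. \<rho> = \<sigma> - {v}} = k + 1"
    using card by (simp add: card_image)
  \<comment> \<open>A \<open>(k + 1)\<close>-simplex containing \<open>\<sigma>\<close> has exactly
    one further vertex, whose removal returns \<open>\<sigma>\<close>.\<close>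
  have cofacet: "(\<exists>v\<in>\<rho>. \<sigma> = \<rho> - {v}) \<longleftrightarrow> \<sigma> \<subseteq> \<rho>" if "\<rho> \<in> simplices \<Gamma> (k + 1)" for \<rho>
  proof
    assume sub: "\<sigma> \<subseteq> \<rho>"
    have "card (\<rho> - \<sigma>) = 1"
      using that card fin sub by (simp add: simplices_def card_Diff_subset)
    then obtain v where "\<rho> - \<sigma> = {v}" by (rule card_1_singletonE)
    then show "\<exists>v\<in>\<rho>. \<sigma> = \<rho> - {v}" using sub by (intro bexI[of _ v]) auto
  qed auto
  have "(\<Sum>\<rho>\<in>simplices \<Gamma> (k - 1). cnj (boundary k \<rho> \<sigma>) * boundary k \<rho> \<sigma>)
      = (\<Sum>\<rho>\<in>simplices \<Gamma> (k - 1). if \<exists>v\<in>\<sigma>. \<rho> = \<sigma> - {v} then 1 else 0)"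
    using boundary_mult_cnj[OF fin card] by (intro sum.cong) (simp_all add: mult.commute)
  also have "\<dots> = of_nat (k + 1)"
    using finite_simplices by (subst sum.inter_filter[symmetric]) (simp_all only: sum_constant down mult_1_right)
  finally have 1: "(\<Sum>\<rho>\<in>simplices \<Gamma> (k - 1). cnj (boundary k \<rho> \<sigma>) * boundary k \<rho> \<sigma>)
      = of_nat (k + 1)" .
  have "(\<Sum>\<rho>\<in>simplices \<Gamma> (k + 1). boundary (k + 1) \<sigma> \<rho> * cnj (boundary (k + 1) \<sigma> \<rho>))
      = (\<Sum>\<rho>\<in>simplices \<Gamma> (k + 1). if \<sigma> \<subseteq> \<rho> then 1 else 0)"
  proof (rule sum.cong)
    fix \<rho> assume \<rho>: "\<rho> \<in> simplices \<Gamma> (k + 1)"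
    then have "card \<rho> = k + 1 + 1" by (simp add: simplices_def)
    from boundary_mult_cnj[OF finite_simplex[OF \<rho>] this, of \<sigma>] cofacet[OF \<rho>]
    show "boundary (k + 1) \<sigma> \<rho> * cnj (boundary (k + 1) \<sigma> \<rho>) = (if \<sigma> \<subseteq> \<rho> then 1 else 0)"
      by simp
  qed simp
  also have "\<dots> = of_nat (up_degree \<Gamma> k \<sigma>)"
    using finite_simplices by (subst sum.inter_filter[symmetric]) (simp_all add: up_degree_def)
  finally show ?thesis using 1 by (simp add: laplacian_def)
qed

text \<open>Each cofacet adds one of the \<open>card V - (k + 1)\<close> vertices outside
  \<open>\<sigma>\<close>. This makes the base of the power in the lower bound nonnegative.\<close>

lemma up_degree_le:
  assumes \<sigma>: "\<sigma> \<in> simplices \<Gamma> k"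
  shows "up_degree \<Gamma> k \<sigma> + k + 1 \<le> card V"
proof -
  have V: "finite V" and sub: "\<And>\<rho>. \<rho> \<in> \<Gamma> \<Longrightarrow> \<rho> \<subseteq> V"
    using cpx by (auto simp: ordered_simplicial_complex_def)
  have card: "card \<sigma> = k + 1" and fin: "finite \<sigma>" and mem: "\<sigma> \<subseteq> V"
    using \<sigma> finite_simplex[OF \<sigma>] sub by (auto simp: simplices_def)
  have "{\<tau> \<in> simplices \<Gamma> (k + 1). \<sigma> \<subseteq> \<tau>} \<subseteq> (\<lambda>v. insert v \<sigma>) ` (V - \<sigma>)"
  proof
    fix \<tau> assume "\<tau> \<in> {\<tau> \<in> simplices \<Gamma> (k + 1). \<sigma> \<subseteq> \<tau>}"
    then have \<tau>: "card \<tau> = k + 1 + 1" "\<sigma> \<subseteq> \<tau>" "\<tau> \<subseteq> V" using sub by (auto simp: simplices_def)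
    have "card (\<tau> - \<sigma>) = 1" using \<tau> card fin by (simp add: card_Diff_subset)
    then obtain v where "\<tau> - \<sigma> = {v}" by (rule card_1_singletonE)
    then show "\<tau> \<in> (\<lambda>v. insert v \<sigma>) ` (V - \<sigma>)" using \<tau> by (intro image_eqI[of _ _ v]) auto
  qed
  then have "up_degree \<Gamma> k \<sigma> \<le> card (V - \<sigma>)"
    unfolding up_degree_def using V by (intro surj_card_le) auto
  also have "\<dots> = card V - (k + 1)" using fin mem card by (simp add: card_Diff_subset)
  finally show ?thesis using card_mono[OF V mem] card by linarith
qed

lemma Hmat_diag:
  assumes "k > 0" "\<sigma> \<in> simplices \<Gamma> k"
  shows "Hmat n \<Gamma> k \<sigma> \<sigma> = of_real (1 - (real (up_degree \<Gamma> k \<sigma>) + real k + 1) / real n)"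
  using laplacian_diag[OF assms] by (simp add: Hmat_def)

lemma max_up_degree_bounds:
  assumes "k > 0" and \<sigma>: "\<sigma> \<in> simplices \<Gamma> k"
  defines "b \<equiv> 1 - (real (max_up_degree \<Gamma> k) + real k + 1) / real (card V)"
  shows "0 \<le> b" and "b \<le> cmod (Hmat (card V) \<Gamma> k \<sigma> \<sigma>)"
proof -
  let ?D = "up_degree \<Gamma> k ` simplices \<Gamma> k"
  have D: "finite ?D" "?D \<noteq> {}" using finite_simplices \<sigma> by auto
  \<comment> \<open>The maximum is attained, so \<open>up_degree_le\<close> applies to it.\<close>
  have "max_up_degree \<Gamma> k \<in> ?D" unfolding max_up_degree_def using D by (rule Max_in)
  then have "max_up_degree \<Gamma> k + k + 1 \<le> card V" using up_degree_le by auto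
  then have "real (max_up_degree \<Gamma> k) + real k + 1 \<le> real (card V)" by linarith
  then show "0 \<le> b" unfolding b_def by (simp add: divide_le_eq_1)
  have "up_degree \<Gamma> k \<sigma> \<le> max_up_degree \<Gamma> k"
    unfolding max_up_degree_def using D \<sigma> by (intro Max_ge) auto
  then have "b \<le> 1 - (real (up_degree \<Gamma> k \<sigma>) + real k + 1) / real (card V)"
    unfolding b_def by (simp add: divide_right_mono)
  also have "\<dots> \<le> cmod (Hmat (card V) \<Gamma> k \<sigma> \<sigma>)"
    unfolding Hmat_diag[OF assms(1,2)] norm_of_real by (rule abs_ge_self)
  finally show "b \<le> cmod (Hmat (card V) \<Gamma> k \<sigma> \<sigma>)" .
qed

end

subsection \<open>Second moments of sample means\<close>

context prob_space
begin

text \<open>Were the probability at least \<open>\<eta>\<close>, the nonnegative function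
  \<open>?g\<close> would have mean at most 0 and vanish almost everywhere. It is positive on
  \<open>?A\<close>, which would then be null, against \<open>\<eta> > 0\<close>.\<close>

lemma strict_second_moment_bound:
  fixes Y :: "'a \<Rightarrow> real"
  assumes [measurable]: "random_variable borel Y" and int: "integrable M (\<lambda>x. (Y x)\<^sup>2)"
    and "\<epsilon> > 0" "\<eta> > 0" and le: "expectation (\<lambda>x. (Y x)\<^sup>2) \<le> \<eta> * \<epsilon>\<^sup>2"
  shows "prob {x \<in> space M. \<bar>Y x\<bar> > \<epsilon>} < \<eta>"
proof (rule ccontr)
  assume "\<not> ?thesis"
  then have ge: "\<eta> \<le> prob {x \<in> space M. \<bar>Y x\<bar> > \<epsilon>}" by simp
  let ?A = "{x \<in> space M. \<bar>Y x\<bar> > \<epsilon>}"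
  let ?g = "\<lambda>x. (Y x)\<^sup>2 - \<epsilon>\<^sup>2 * indicator ?A x"
  have A: "?A \<in> events" by measurable
  have sq: "\<epsilon>\<^sup>2 < (Y x)\<^sup>2" if "\<bar>Y x\<bar> > \<epsilon>" for x
    using that \<open>\<epsilon> > 0\<close> by (metis abs_of_pos power2_abs power_strict_mono less_imp_le zero_less_numeral)
  have ind: "integrable M (\<lambda>x. \<epsilon>\<^sup>2 * indicator ?A x)"
    using A by (intro integrable_mult_right integrable_real_indicator) (auto simp: emeasure_eq_measure)
  have g: "integrable M ?g" using int ind by (rule Bochner_Integration.integrable_diff)
  have nn: "0 \<le> ?g x" for x using sq[of x] by (auto simp: indicator_def)
  have "expectation ?g = expectation (\<lambda>x. (Y x)\<^sup>2) - \<epsilon>\<^sup>2 * prob ?A"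
    using int ind A by (subst Bochner_Integration.integral_diff) auto
  also have "\<dots> \<le> \<eta> * \<epsilon>\<^sup>2 - \<epsilon>\<^sup>2 * \<eta>"
    using le ge \<open>\<epsilon> > 0\<close> by (intro diff_mono mult_left_mono) auto
  finally have "expectation ?g \<le> 0" by (simp add: mult.commute)
  moreover have "0 \<le> expectation ?g" by (rule Bochner_Integration.integral_nonneg) (rule nn)
  ultimately have "expectation ?g = 0" by linarith
  then have "AE x in M. ?g x = 0" using g nn by (subst (asm) integral_nonneg_eq_0_iff_AE) auto
  then have "AE x in M. x \<notin> ?A"
    by (rule AE_mp) (auto intro!: AE_I2 simp: indicator_def dest!: sq split: if_splits)
  then have "prob ?A = 0" using A prob_eq_0 by blast
  then show False using ge \<open>\<eta> > 0\<close> by simp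
qed

text \<open>Independence removes the covariances, leaving \<open>N\<close> variances over the square
  of \<open>N\<close>; each variance is at most the second moment.\<close>

lemma sample_mean_second_moment:
  fixes Y :: "nat \<Rightarrow> 'a \<Rightarrow> real"
  assumes ind: "indep_vars (\<lambda>_. borel) Y {1..N}" and "N \<ge> 1"
    and int: "\<And>i. i \<in> {1..N} \<Longrightarrow> integrable M (\<lambda>x. (Y i x)\<^sup>2)"
    and mean: "\<And>i. i \<in> {1..N} \<Longrightarrow> expectation (Y i) = \<mu>"
    and sq: "\<And>i. i \<in> {1..N} \<Longrightarrow> expectation (\<lambda>x. (Y i x)\<^sup>2) \<le> v"
  shows "integrable M (\<lambda>x. (1 / real N * (\<Sum>i=1..N. Y i x) - \<mu>)\<^sup>2)"
    and "expectation (\<lambda>x. (1 / real N * (\<Sum>i=1..N. Y i x) - \<mu>)\<^sup>2) \<le> v / real N"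
proof -
  define Z where "Z i x = Y i x - \<mu>" for i x
  have rvY: "random_variable borel (Y i)" if "i \<in> {1..N}" for i
    using ind that by (auto simp: indep_vars_def)
  have intY: "integrable M (Y i)" if "i \<in> {1..N}" for i
    using square_integrable_imp_integrable[OF rvY int] that by blast
  have intZ: "integrable M (Z i)" and meanZ: "expectation (Z i) = 0" if "i \<in> {1..N}" for i
    using intY[OF that] mean[OF that] by (auto simp: Z_def[abs_def] prob_space)
  have indZ: "indep_vars (\<lambda>_. borel) Z {1..N}"
    using indep_vars_compose2[OF ind, of "\<lambda>_ y. y - \<mu>" "\<lambda>_. borel"] by (simp add: Z_def[abs_def])
  have Zsq: "(Z i x)\<^sup>2 = (Y i x)\<^sup>2 - 2 * \<mu> * Y i x + \<mu>\<^sup>2" for i x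
    by (simp add: Z_def power2_diff)
  have intZsq: "integrable M (\<lambda>x. (Z i x)\<^sup>2)" if "i \<in> {1..N}" for i
    unfolding Zsq using int[OF that] intY[OF that] by simp
  have EZsq: "expectation (\<lambda>x. (Z i x)\<^sup>2) \<le> v" if "i \<in> {1..N}" for i
  proof -
    have "expectation (\<lambda>x. (Z i x)\<^sup>2) = expectation (\<lambda>x. (Y i x)\<^sup>2) - \<mu>\<^sup>2"
      unfolding Zsq using int[OF that] intY[OF that] mean[OF that]
      by (simp add: prob_space power2_eq_square)
    then show ?thesis using sq[OF that] zero_le_power2[of \<mu>] by linarith
  qed
  have cross: "integrable M (\<lambda>x. Z i x * Z j x) \<and> expectation (\<lambda>x. Z i x * Z j x) = 0"
    if "i \<in> {1..N}" "j \<in> {1..N}" "i \<noteq> j" for i j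
  proof -
    have *: "indep_vars (\<lambda>_. borel) Z {i, j}" using indZ that by (intro indep_vars_subset[OF indZ]) auto
    have "integrable M (\<lambda>x. \<Prod>i\<in>{i, j}. Z i x)"
      using intZ that by (intro indep_vars_integrable[OF _ *]) auto
    moreover have "expectation (\<lambda>x. \<Prod>i\<in>{i, j}. Z i x) = (\<Prod>i\<in>{i, j}. expectation (Z i))"
      using intZ that by (intro indep_vars_lebesgue_integral[OF _ *]) auto
    ultimately show ?thesis using that meanZ by simp
  qed
  have prod: "integrable M (\<lambda>x. Z i x * Z j x)" if "i \<in> {1..N}" "j \<in> {1..N}" for i j
    using cross[OF that] intZsq[OF that(1)] by (cases "i = j") (auto simp: power2_eq_square)
  have Eprod: "expectation (\<lambda>x. Z i x * Z j x) = (if j = i then expectation (\<lambda>x. (Z i x)\<^sup>2) else 0)"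
    if "i \<in> {1..N}" "j \<in> {1..N}" for i j
    using cross[OF that] by (auto simp: power2_eq_square)
  have eq: "(1 / real N * (\<Sum>i=1..N. Y i x) - \<mu>)\<^sup>2
      = 1 / (real N)\<^sup>2 * (\<Sum>i=1..N. \<Sum>j=1..N. Z i x * Z j x)" for x
  proof -
    have "1 / real N * (\<Sum>i=1..N. Y i x) - \<mu> = 1 / real N * (\<Sum>i=1..N. Z i x)"
      using \<open>N \<ge> 1\<close> by (simp add: Z_def sum_subtractf field_simps)
    then show ?thesis
      by (simp only: power_mult_distrib power2_eq_square[of "sum _ _"] sum_product power_divide power_one)
  qed
  show "integrable M (\<lambda>x. (1 / real N * (\<Sum>i=1..N. Y i x) - \<mu>)\<^sup>2)"
    unfolding eq by (intro integrable_mult_right Bochner_Integration.integrable_sum prod)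
  have "expectation (\<lambda>x. (1 / real N * (\<Sum>i=1..N. Y i x) - \<mu>)\<^sup>2)
      = 1 / (real N)\<^sup>2 * (\<Sum>i=1..N. \<Sum>j=1..N. expectation (\<lambda>x. Z i x * Z j x))"
    unfolding eq
    by (simp only: integral_mult_right_zero Bochner_Integration.integral_sum prod
        Bochner_Integration.integrable_sum cong: sum.cong)
  also have "(\<Sum>i=1..N. \<Sum>j=1..N. expectation (\<lambda>x. Z i x * Z j x))
      = (\<Sum>i=1..N. \<Sum>j=1..N. if j = i then expectation (\<lambda>x. (Z i x)\<^sup>2) else 0)"
    by (intro sum.cong Eprod) auto
  also have "\<dots> = (\<Sum>i=1..N. expectation (\<lambda>x. (Z i x)\<^sup>2))"
    by (intro sum.cong) auto
  also have "1 / (real N)\<^sup>2 * \<dots> \<le> 1 / (real N)\<^sup>2 * (\<Sum>i=1..N. v)"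
    by (intro mult_left_mono sum_mono EZsq) auto
  also have "\<dots> = v / real N" by (simp add: power2_eq_square)
  finally show "expectation (\<lambda>x. (1 / real N * (\<Sum>i=1..N. Y i x) - \<mu>)\<^sup>2) \<le> v / real N" .
qed

lemma sample_mean_is_estimate:
  fixes Y :: "nat \<Rightarrow> 'a \<Rightarrow> real"
  assumes ind: "indep_vars (\<lambda>_. borel) Y {1..N}" and "N \<ge> 1" and "\<epsilon> > 0" "\<eta> > 0"
    and int: "\<And>i. i \<in> {1..N} \<Longrightarrow> integrable M (\<lambda>x. (Y i x)\<^sup>2)"
    and mean: "\<And>i. i \<in> {1..N} \<Longrightarrow> expectation (Y i) = \<mu>"
    and sq: "\<And>i. i \<in> {1..N} \<Longrightarrow> expectation (\<lambda>x. (Y i x)\<^sup>2) \<le> v"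
    and N: "real N \<ge> 1 / (\<eta> * \<epsilon>\<^sup>2) * v"
  shows "is_estimate M \<epsilon> \<eta> (\<lambda>x. 1 / real N * (\<Sum>i=1..N. Y i x)) \<mu>"
proof -
  have [measurable]: "Y i \<in> borel_measurable M" if "i \<in> {1..N}" for i
    using ind that by (auto simp: indep_vars_def)
  have meas: "(\<lambda>x. 1 / real N * (\<Sum>i=1..N. Y i x)) \<in> borel_measurable M"
    by (intro borel_measurable_times borel_measurable_const borel_measurable_sum) simp
  \<comment> \<open>The lower bound on \<open>N\<close>, rearranged into the hypothesis of
    \<open>strict_second_moment_bound\<close>.\<close>
  have "v / real N \<le> \<eta> * \<epsilon>\<^sup>2"
    using N assms(2-4) by (simp add: field_simps)
  then have "prob {x \<in> space M. \<bar>1 / real N * (\<Sum>i=1..N. Y i x) - \<mu>\<bar> > \<epsilon>} < \<eta>"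
    using sample_mean_second_moment[OF ind \<open>N \<ge> 1\<close> int mean sq] meas assms(3,4)
    by (intro strict_second_moment_bound) auto
  then show ?thesis unfolding is_estimate_def using meas by blast
qed

end

subsection \<open>The path estimator\<close>

text \<open>The trace is real by \<open>trace_Hmat_power_real\<close>, so taking \<open>Re\<close>
  of it loses nothing.\<close>

theorem theorem5:
  fixes V :: "'v::linorder set" and \<Gamma> :: "'v set set" and k l :: nat
    and K :: "'v set \<Rightarrow> 'v set pmf"
  defines "n \<equiv> card V"
    and "S \<equiv> simplices \<Gamma> k"
  assumes "ordered_simplicial_complex V \<Gamma>"
    and "k > 0"
    and "l \<ge> 1"
    and "S \<noteq> {}"
    and "transition_kernel n \<Gamma> k K"
  shows
    "(1 - (real (max_up_degree \<Gamma> k) + real k + 1) / real n) ^ l *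
        (1 / real (card S) * (\<Sum>\<sigma>\<in>S. Hnorm n \<Gamma> k \<sigma> ^ l))
      \<le> measure_pmf.expectation (random_path S K l) (\<lambda>p. \<bar>f_path n \<Gamma> k l p\<bar>\<^sup>2) \<and>
     measure_pmf.expectation (random_path S K l) (\<lambda>p. \<bar>f_path n \<Gamma> k l p\<bar>\<^sup>2)
      \<le> 1 / real (card S) * (\<Sum>\<sigma>\<in>S. Hnorm n \<Gamma> k \<sigma> ^ (2 * l)) \<and>
     (\<forall>(M :: 'w measure) (X :: nat \<Rightarrow> 'w \<Rightarrow> 'v set list) (N :: nat) (\<epsilon> :: real) (\<eta> :: real).
        prob_space M \<longrightarrow>
        \<epsilon> > 0 \<longrightarrow> \<eta> > 0 \<longrightarrow> N \<ge> 1 \<longrightarrow>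
        prob_space.indep_vars M (\<lambda>_. count_space UNIV) X {1..N} \<longrightarrow>
        (\<forall>i\<in>{1..N}. distr M (count_space UNIV) (X i) = measure_pmf (random_path S K l)) \<longrightarrow>
        real N \<ge> 1 / (\<eta> * \<epsilon>\<^sup>2) * (1 / real (card S) * (\<Sum>\<sigma>\<in>S. Hnorm n \<Gamma> k \<sigma> ^ (2 * l))) \<longrightarrow>
        is_estimate M \<epsilon> \<eta> (\<lambda>\<omega>. 1 / real N * (\<Sum>i=1..N. f_path n \<Gamma> k l (X i \<omega>)))
          (1 / real (card S) * Re (mat_trace S (mat_power S (Hmat n \<Gamma> k) l))))"
proof -
  let ?H = "Hmat n \<Gamma> k" and ?c = "Hnorm n \<Gamma> k" and ?f = "f_path n \<Gamma> k l"
  let ?E = "measure_pmf.expectation (random_path S K l)"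
  define A where "A i j = cmod (?H i j)" for i j
  define g where "g i j = sgn (Re (?H i j)) * ?c i" for i j
  define \<mu> where "\<mu> = 1 / real (card S) * Re (mat_trace S (mat_power S ?H l))"
  define v where "v = 1 / real (card S) * (\<Sum>\<sigma>\<in>S. ?c \<sigma> ^ (2 * l))"
  note cpx = \<open>ordered_simplicial_complex V \<Gamma>\<close>
  have fin: "finite S" unfolding S_def by (rule finite_simplices[OF cpx])
  have K: "set_pmf (K \<sigma>) \<subseteq> S" if "\<sigma> \<in> S" for \<sigma>
    using \<open>transition_kernel n \<Gamma> k K\<close> that by (auto simp: transition_kernel_def S_def)
  have sym: "A i j = A j i" for i j unfolding A_def by (rule cmod_Hmat_sym)
  have nn: "0 \<le> A i j" for i j by (simp add: A_def)
  have rows: "(\<Sum>j\<in>S. A i j) = ?c i" for i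
    unfolding Hnorm_def S_def A_def by (intro sum.cong cmod_Hmat_sym) simp
  have H_real: "?H i j = complex_of_real (Re (?H i j))" for i j
    using Hmat_real by (metis of_real_Re)
  have A_Re: "A i j = \<bar>Re (?H i j)\<bar>" for i j
    unfolding A_def by (subst H_real) (rule norm_of_real)
  \<comment> \<open>The weight cancels the normalisation of the chain. If \<open>?c i = 0\<close>,
    the whole row of \<open>A\<close> vanishes, so the arbitrary choice of \<open>K i\<close> has no
    effect.\<close>
  have step: "pmf (K i) j * ?c i = A i j" if "i \<in> S" "j \<in> S" for i j
  proof (cases "?c i = 0")
    case True
    then have "A i j = 0"
      using rows[of i] that fin nn by (simp add: sum_nonneg_eq_0_iff)
    then show ?thesis using True by simp
  next
    case False
    then have "pmf (K i) j = A j i / ?c i"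
      using \<open>transition_kernel n \<Gamma> k K\<close> that
      by (simp add: transition_kernel_def S_def trans_prob_def A_def)
    then show ?thesis using False sym[of i j] by simp
  qed
  have f: "?f p = (if p ! l = p ! 0 then 1 else 0) * (\<Prod>i<l. g (p ! i) (p ! (i + 1)))" for p
    by (simp add: f_path_def g_def)
  \<comment> \<open>The indicator is idempotent, so the square is again a closed-path product, now
    with edge factor \<open>g\<close> squared.\<close>
  have f_sq: "\<bar>?f p\<bar>\<^sup>2
      = (if p ! l = p ! 0 then 1 else 0) * (\<Prod>i<l. (g (p ! i) (p ! (i + 1)))\<^sup>2)" for p
    by (simp add: f power_mult_distrib prod_power_distrib)
  \<comment> \<open>The sign in \<open>g\<close> turns \<open>A i j\<close> back into the entry of
    \<open>?H\<close>, whence the trace of its power as the mean.\<close>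
  have "pmf (K i) j * g i j = Re (?H i j)" if "i \<in> S" "j \<in> S" for i j
  proof -
    have "pmf (K i) j * g i j = sgn (Re (?H i j)) * (pmf (K i) j * ?c i)" by (simp add: g_def)
    also have "\<dots> = Re (?H i j)" by (simp add: step[OF that] A_Re sgn_mult_abs)
    finally show ?thesis .
  qed
  then have "(\<Sum>\<sigma>\<in>S. walk_sum S (\<lambda>i j. pmf (K i) j * g i j) l \<sigma> \<sigma>)
      = (\<Sum>\<sigma>\<in>S. walk_sum S (\<lambda>i j. Re (?H i j)) l \<sigma> \<sigma>)"
    by (intro sum.cong walk_sum_cong) auto
  also have "\<dots> = Re (mat_trace S (mat_power S (\<lambda>i j. complex_of_real (Re (?H i j))) l))"
    by (simp add: mat_trace_def mat_power_of_real)
  also have "(\<lambda>i j. complex_of_real (Re (?H i j))) = ?H" using H_real by presburger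
  finally have mean: "?E ?f = \<mu>"
    unfolding f \<mu>_def
    by (subst expectation_random_path_closed[OF fin \<open>S \<noteq> {}\<close> K, where g = g]) auto
  \<comment> \<open>Only one of the two factors \<open>?c i\<close> is cancelled. The squared sign
    is 1, or 0 where \<open>A i j\<close> is 0 as well.\<close>
  have "pmf (K i) j * (g i j)\<^sup>2 = ?c i * A i j" if "i \<in> S" "j \<in> S" for i j
  proof -
    have "pmf (K i) j * (g i j)\<^sup>2 = ?c i * ((sgn (Re (?H i j)))\<^sup>2 * (pmf (K i) j * ?c i))"
      by (simp add: g_def power2_eq_square)
    also have "\<dots> = ?c i * A i j" by (simp add: step[OF that] A_Re sgn_if)
    finally show ?thesis .
  qed
  then have "(\<Sum>\<sigma>\<in>S. walk_sum S (\<lambda>i j. pmf (K i) j * (g i j)\<^sup>2) l \<sigma> \<sigma>)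
      = (\<Sum>\<sigma>\<in>S. walk_sum S (\<lambda>i j. ?c i * A i j) l \<sigma> \<sigma>)"
    by (intro sum.cong walk_sum_cong) auto
  then have second: "?E (\<lambda>p. \<bar>?f p\<bar>\<^sup>2)
      = 1 / real (card S) * (\<Sum>\<sigma>\<in>S. walk_sum S (\<lambda>i j. ?c i * A i j) l \<sigma> \<sigma>)"
    unfolding f_sq
    by (subst expectation_random_path_closed[OF fin \<open>S \<noteq> {}\<close> K, where g = "\<lambda>i j. (g i j)\<^sup>2"]) auto
  have upper: "?E (\<lambda>p. \<bar>?f p\<bar>\<^sup>2) \<le> v"
    unfolding second v_def
    by (intro mult_left_mono trace_row_weighted_power_le fin sym nn rows \<open>l \<ge> 1\<close>) simp
  let ?b = "1 - (real (max_up_degree \<Gamma> k) + real k + 1) / real n"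
  have c_nn: "0 \<le> ?c i" for i unfolding Hnorm_def by (simp add: sum_nonneg)
  have "?b ^ l * ?c \<sigma> ^ l \<le> walk_sum S (\<lambda>i j. ?c i * A i j) l \<sigma> \<sigma>" if "\<sigma> \<in> S" for \<sigma>
  proof -
    have "0 \<le> ?b" "?b \<le> A \<sigma> \<sigma>"
      using max_up_degree_bounds[OF cpx \<open>k > 0\<close>] that by (auto simp: S_def n_def A_def)
    then have "?b ^ l * ?c \<sigma> ^ l \<le> (?c \<sigma> * A \<sigma> \<sigma>) ^ l"
      using c_nn[of \<sigma>] by (simp add: power_mult_distrib mult.commute[of "?c \<sigma> ^ l"] mult_right_mono power_mono)
    also have "\<dots> \<le> walk_sum S (\<lambda>i j. ?c i * A i j) l \<sigma> \<sigma>"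
      using diagonal_power_le_walk_sum[OF fin _ that, of "\<lambda>i j. ?c i * A i j" l] c_nn nn by simp
    finally show ?thesis .
  qed
  then have "(\<Sum>\<sigma>\<in>S. ?b ^ l * ?c \<sigma> ^ l) \<le> (\<Sum>\<sigma>\<in>S. walk_sum S (\<lambda>i j. ?c i * A i j) l \<sigma> \<sigma>)"
    by (intro sum_mono)
  then have "1 / real (card S) * (\<Sum>\<sigma>\<in>S. ?b ^ l * ?c \<sigma> ^ l) \<le> ?E (\<lambda>p. \<bar>?f p\<bar>\<^sup>2)"
    unfolding second by (intro mult_left_mono) auto
  then have lower: "?b ^ l * (1 / real (card S) * (\<Sum>\<sigma>\<in>S. ?c \<sigma> ^ l)) \<le> ?E (\<lambda>p. \<bar>?f p\<bar>\<^sup>2)"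
    by (simp add: mult.left_commute flip: sum_distrib_left)
  have est: "is_estimate M \<epsilon> \<eta> (\<lambda>\<omega>. 1 / real N * (\<Sum>i=1..N. ?f (X i \<omega>))) \<mu>"
    if M: "prob_space M" and pos: "\<epsilon> > 0" "\<eta> > 0" "N \<ge> 1"
      and ind: "prob_space.indep_vars M (\<lambda>_. count_space UNIV) X {1..N}"
      and X: "\<forall>i\<in>{1..N}. distr M (count_space UNIV) (X i) = measure_pmf (random_path S K l)"
      and N: "real N \<ge> 1 / (\<eta> * \<epsilon>\<^sup>2) * v"
    for M :: "'w measure" and X :: "nat \<Rightarrow> 'w \<Rightarrow> 'v set list" and N \<epsilon> \<eta>
  proof -
    interpret prob_space M by (rule M)
    have rv: "X i \<in> measurable M (count_space UNIV)" if "i \<in> {1..N}" for i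
      using ind that by (auto simp: indep_vars_def)
    \<comment> \<open>Expectations are transported along the law of the sample; finite support of
      the path distribution gives integrability.\<close>
    have push: "expectation (\<lambda>\<omega>. h (X i \<omega>)) = ?E h" "integrable M (\<lambda>\<omega>. h (X i \<omega>))"
      if i: "i \<in> {1..N}" for h :: "'v set list \<Rightarrow> real" and i
    proof -
      note Xi = X[rule_format, OF i]
      show "expectation (\<lambda>\<omega>. h (X i \<omega>)) = ?E h"
        using integral_distr[OF rv[OF i], of h] by (simp add: Xi)
      have "integrable (random_path S K l) h"
        by (intro integrable_measure_pmf_finite finite_set_random_path fin \<open>S \<noteq> {}\<close> K)
      then show "integrable M (\<lambda>\<omega>. h (X i \<omega>))"
        using integrable_distr_eq[OF rv[OF i], of h] by (simp add: Xi)
    qed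
    show ?thesis
    proof (rule sample_mean_is_estimate[OF _ pos(3,1,2) _ _ _ N])
      show "indep_vars (\<lambda>_. borel) (\<lambda>i \<omega>. ?f (X i \<omega>)) {1..N}"
        by (rule indep_vars_compose2[OF ind]) simp
    next
      fix i assume i: "i \<in> {1..N}"
      show "integrable M (\<lambda>\<omega>. (?f (X i \<omega>))\<^sup>2)" by (rule push(2)[OF i, of "\<lambda>p. (?f p)\<^sup>2"])
      show "expectation (\<lambda>\<omega>. ?f (X i \<omega>)) = \<mu>" using push(1)[OF i, of ?f] mean by simp
      show "expectation (\<lambda>\<omega>. (?f (X i \<omega>))\<^sup>2) \<le> v"
        using push(1)[OF i, of "\<lambda>p. (?f p)\<^sup>2"] upper by simp
    qed
  qed
  show ?thesis
    using lower upper est unfolding \<mu>_def v_def by blast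
qed

end
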